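(* Let $x,\lambda\in\mathbb{R}$ and $n\in\mathbb{N}$ ($n\ge 1$), and let $P_{n,\lambda}[x]$ be the $(n+1)\times(n+1)$ lower triangular matrix with entries $(P_{n,\lambda}[x])_{ij}=x^{(i-j)|\lambda}\binom{i-1}{j-1}$ for $1\le j\le i\le n+1$ and $0$ for $j>i$. Then $P_{n,\lambda}[x]$ is a totally positive matrix if and only if one of the following conditions holds: i) $x\ge (n-1)|\lambda|$; ii) $x=k|\lambda|$ for some $k\in\{0,\ldots,n-1\}$.
   Context: For real $x,\lambda$ and an integer $m\ge 0$, $x^{m|\lambda}:=x(x+\lambda)\cdots(x+(m-1)\lambda)$ if $m>0$, and $x^{0|\lambda}:=1$ (this notation is unrelated to the absolute value $|\lambda|$ appearing in conditions i) and ii)). A real matrix is called totally positive (TP) if all its minors are nonnegative. *)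

theory Defs
  imports
    Complex_Main
    "Jordan_Normal_Form.Determinant"
    "Jordan_Normal_Form.DL_Submatrix"
begin

definition rising_power :: "real \<Rightarrow> real \<Rightarrow> nat \<Rightarrow> real" where
  "rising_power x l m = (\<Prod>k<m. x + real k * l)"

text \<open>Matrices of type \<^typ>\<open>real mat\<close> are indexed from 0, so the row and column indices are
  shifted by one with respect to the usual 1-based description: the 1-based entry
  \<open>(i, j)\<close>, with binomial coefficient \<open>(i - 1) choose (j - 1)\<close>, is the entry
  \<open>(i - 1, j - 1)\<close> here.\<close>

definition pascal_mat :: "nat \<Rightarrow> real \<Rightarrow> real \<Rightarrow> real mat" where
  "pascal_mat n l x = mat (n + 1) (n + 1)
     (\<lambda>(i, j). if j \<le> i then rising_power x l (i - j) * real (i choose j) else 0)"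

text \<open>A minor is the determinant of a square submatrix, given by a set \<open>I\<close> of rows and a
  set \<open>J\<close> of columns of equal cardinality; \<^const>\<open>submatrix\<close> keeps them in increasing order.
  The empty minor is 1, so admitting empty \<open>I\<close> and \<open>J\<close> is harmless.\<close>

definition totally_positive :: "real mat \<Rightarrow> bool" where
  "totally_positive A \<longleftrightarrow>
     (\<forall>I J. I \<subseteq> {0..<dim_row A} \<longrightarrow> J \<subseteq> {0..<dim_col A} \<longrightarrow> card I = card J \<longrightarrow>
        0 \<le> det (submatrix A I J))"

end

theory Submission
  imports Defs
begin

text \<open>
  Write \<open>P[x]\<close> for the matrix with step \<open>l\<close>. Adding to one row a nonnegative multiple of the
  preceding row preserves total positivity. Neville elimination of the first column reduces
  \<open>P[x]\<close> to \<open>1 \<oplus> P[x - l]\<close> of smaller size with multipliers \<open>x + i l\<close>, which are nonnegative in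
  case i), and also in case ii) when \<open>l \<ge> 0\<close>. When \<open>l < 0\<close> and \<open>x = k \<bar>l\<bar>\<close>, the matrix is the
  \<open>k\<close>-th power of the nonnegative bidiagonal matrix \<open>P[\<bar>l\<bar>]\<close>.

  Conversely, the first column of \<open>P[x]\<close> gives \<open>x(x + l)\<dots>(x + (m - 1) l) \<ge> 0\<close> and, since the
  inverse of \<open>P[x]\<close> is \<open>P[-x]\<close>, the minors on rows \<open>1..m\<close> and columns \<open>0..m - 1\<close> give the same
  inequality for \<open>-l\<close>. So \<open>x(x - \<bar>l\<bar>)\<dots>(x - (m - 1) \<bar>l\<bar>) \<ge> 0\<close> for all \<open>m \<le> n\<close>; if
  \<open>k \<bar>l\<bar> < x < (k + 1) \<bar>l\<bar>\<close> with \<open>k + 2 \<le> n\<close>, then this fails at \<open>m = k + 2\<close>.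
\<close>

section \<open>Minors indexed by increasing maps\<close>

text \<open>The three matrices differ only in row \<open>a\<close>, so they share the cofactors
  along that row, and Laplace expansion there is linear in its entries.\<close>

lemma det_mat_row_linear:
  fixes A B C :: "nat \<Rightarrow> nat \<Rightarrow> 'a::comm_ring_1"
  assumes "a < r"
    and "\<And>i j. i \<noteq> a \<Longrightarrow> B i j = A i j"
    and "\<And>i j. i \<noteq> a \<Longrightarrow> C i j = A i j"
    and "\<And>j. A a j = B a j + c * C a j"
  shows "det (mat r r (\<lambda>(i, j). A i j)) =
    det (mat r r (\<lambda>(i, j). B i j)) + c * det (mat r r (\<lambda>(i, j). C i j))"
proof -
  let ?M = "\<lambda>A. mat r r (\<lambda>(i, j). A i j) :: 'a mat"
  have exp: "det (?M X) = (\<Sum>j<r. X a j * cofactor (?M X) a j)" for X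
    using laplace_expansion_row[of "?M X" r a] \<open>a < r\<close> by simp
  have "mat_delete (?M B) a j = mat_delete (?M A) a j"
    "mat_delete (?M C) a j = mat_delete (?M A) a j" for j
    using assms(1-3) by (auto simp: mat_delete_def intro!: eq_matI)
  then have "cofactor (?M B) a j = cofactor (?M A) a j"
    "cofactor (?M C) a j = cofactor (?M A) a j" for j
    by (simp_all add: cofactor_def)
  then show ?thesis
    by (simp add: exp assms(4) sum_distrib_left sum.distrib[symmetric] algebra_simps)
qed

text \<open>Rows and columns are selected by maps rather than sets, so that exchanging one row is a
  function update and repeated rows remain meaningful.\<close>

definition minor :: "(nat \<Rightarrow> nat \<Rightarrow> real) \<Rightarrow> nat \<Rightarrow> (nat \<Rightarrow> nat) \<Rightarrow> (nat \<Rightarrow> nat) \<Rightarrow> real" where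
  "minor A r f g = det (mat r r (\<lambda>(a, b). A (f a) (g b)))"

text \<open>Matrices are functions on all of \<open>nat\<close> and \<open>N\<close> only bounds the
  indices, so inductions can change the size without dimension bookkeeping.\<close>

definition tp_upto :: "nat \<Rightarrow> (nat \<Rightarrow> nat \<Rightarrow> real) \<Rightarrow> bool" where
  "tp_upto N A \<longleftrightarrow> (\<forall>r f g. strict_mono_on {..<r} f \<longrightarrow> strict_mono_on {..<r} g \<longrightarrow>
     f ` {..<r} \<subseteq> {..<N} \<longrightarrow> g ` {..<r} \<subseteq> {..<N} \<longrightarrow> 0 \<le> minor A r f g)"

lemma tp_uptoD:
  assumes "tp_upto N A" "strict_mono_on {..<r} f" "strict_mono_on {..<r} g"
    and "\<And>a. a < r \<Longrightarrow> f a < N" "\<And>a. a < r \<Longrightarrow> g a < N"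
  shows "0 \<le> minor A r f g"
proof -
  have "f ` {..<r} \<subseteq> {..<N}" "g ` {..<r} \<subseteq> {..<N}"
    using assms(4,5) by auto
  with assms(1-3) show ?thesis
    unfolding tp_upto_def by blast
qed

lemma minor_cong:
  assumes "\<And>a b. a < r \<Longrightarrow> b < r \<Longrightarrow> A (f a) (g b) = B (f' a) (g' b)"
  shows "minor A r f g = minor B r f' g'"
  unfolding minor_def using assms by (intro arg_cong[where f = det] eq_matI) auto

lemma tp_upto_cong:
  assumes "\<And>i j. i < N \<Longrightarrow> j < N \<Longrightarrow> A i j = B i j"
  shows "tp_upto N A \<longleftrightarrow> tp_upto N B"
proof -
  have "minor A r f g = minor B r f g"
    if "f ` {..<r} \<subseteq> {..<N}" "g ` {..<r} \<subseteq> {..<N}" for r :: nat and f g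
    using that by (intro minor_cong assms) auto
  then show ?thesis
    unfolding tp_upto_def by metis
qed

section \<open>Row operations that preserve total positivity\<close>

lemma minor_eq_0_if_equal_rows:
  assumes "a < r" "b < r" "a \<noteq> b" "f a = f b"
  shows "minor A r f g = 0"
  unfolding minor_def
  by (rule det_identical_rows[of _ r a b]) (use assms in auto)

text \<open>If \<open>f\<close> is monotone but not strictly so, a row is repeated and the
  determinant vanishes.\<close>

lemma minor_nonneg_if_mono:
  assumes "tp_upto N A" "mono_on {..<r} f" "strict_mono_on {..<r} g"
    and "f ` {..<r} \<subseteq> {..<N}" "g ` {..<r} \<subseteq> {..<N}"
  shows "0 \<le> minor A r f g"
proof (cases "inj_on f {..<r}")
  case True
  with assms(2) have "strict_mono_on {..<r} f"
    by (auto simp: strict_mono_on_def monotone_on_def inj_on_def order_less_le)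
  then show ?thesis
    using assms by (auto simp: tp_upto_def)
next
  case False
  then obtain a b where "a < r" "b < r" "a \<noteq> b" "f a = f b"
    by (auto simp: inj_on_def)
  then show ?thesis
    by (simp add: minor_eq_0_if_equal_rows)
qed

text \<open>By linearity in the changed row, a minor of the new matrix is the old minor plus
  \<open>c\<close> times the minor with \<open>Suc s\<close> replaced by \<open>s\<close>. As the
  two indices are adjacent, the row map stays monotone; at worst \<open>s\<close> now occurs
  twice.\<close>

lemma tp_upto_add_previous_row:
  assumes tp: "tp_upto N A" and "0 \<le> c"
  shows "tp_upto N (\<lambda>i j. if i = Suc s then A (Suc s) j + c * A s j else A i j)"
    (is "tp_upto N ?B")
  unfolding tp_upto_def
proof (intro allI impI)
  fix r :: nat and f g
  assume f: "strict_mono_on {..<r} f" "f ` {..<r} \<subseteq> {..<N}"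
    and g: "strict_mono_on {..<r} g" "g ` {..<r} \<subseteq> {..<N}"
  have A: "0 \<le> minor A r f g"
    using tp f g by (auto simp: tp_upto_def)
  show "0 \<le> minor ?B r f g"
  proof (cases "\<exists>a<r. f a = Suc s")
    case False
    then have "minor ?B r f g = minor A r f g"
      by (intro minor_cong) auto
    with A show ?thesis by simp
  next
    case True
    then obtain a where a: "a < r" "f a = Suc s"
      by blast
    have ne: "f i \<noteq> Suc s" if "i < r" "i \<noteq> a" for i
      using f(1) a that by (metis lessThan_iff linorder_neqE_nat order_less_irrefl strict_mono_onD)
    have "mono_on {..<r} (f(a := s))"
    proof (rule mono_onI)
      fix x y assume xy: "x \<in> {..<r}" "y \<in> {..<r}" "x \<le> y"
      show "(f(a := s)) x \<le> (f(a := s)) y"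
      proof (cases "x = y")
        case False
        then have "f x < f y"
          using f(1) xy by (auto simp: strict_mono_on_def)
        then show ?thesis
          using a by auto
      qed simp
    qed
    moreover have "(f(a := s)) ` {..<r} \<subseteq> {..<N}"
      using f(2) a by (force simp: image_subset_iff)
    ultimately have C: "0 \<le> minor A r (f(a := s)) g"
      using minor_nonneg_if_mono tp g by blast
    have "minor ?B r f g = det (mat r r (\<lambda>(i, j).
        (if i = a then A (Suc s) (g j) + c * A s (g j) else A (f i) (g j))))"
      unfolding minor_def using a ne by (intro arg_cong[where f = det] eq_matI) auto
    also have "\<dots> = minor A r f g + c * minor A r (f(a := s)) g"
      unfolding minor_def by (intro det_mat_row_linear[OF a(1)]) (use a in auto)
    finally show ?thesis
      using A C \<open>0 \<le> c\<close> by simp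
  qed
qed

text \<open>In matrix form \<open>B = L A\<close>, where \<open>L\<close> is unit lower bidiagonal
  with subdiagonal \<open>c\<close>.\<close>

lemma tp_upto_lower_bidiagonal:
  assumes "tp_upto N A" and c: "\<And>i. Suc i < N \<Longrightarrow> 0 \<le> c i"
    and B: "\<And>j. B 0 j = A 0 j" "\<And>i j. B (Suc i) j = A (Suc i) j + c i * A i j"
  shows "tp_upto N B"
proof -
  \<comment> \<open>Rows are updated from the bottom up, so each update still sees the old previous row.\<close>
  have rows: "tp_upto N (\<lambda>i j. if i < N - s then A i j else B i j)" if "s < N" for s
    using that
  proof (induction s)
    case 0
    have "tp_upto N (\<lambda>i j. if i < N - 0 then A i j else B i j) = tp_upto N A"
      by (rule tp_upto_cong) auto
    then show ?case
      using assms(1) by blast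
  next
    case (Suc s)
    \<comment> \<open>\<open>Suc t\<close> is the last row not yet updated, with its index written
      as a successor.\<close>
    define t where "t = N - Suc (Suc s)"
    have t: "N - Suc s = Suc t" "N - s = Suc (Suc t)" "Suc t < N"
      using Suc.prems by (auto simp: t_def)
    have "tp_upto N (\<lambda>i j. if i < Suc (Suc t) then A i j else B i j)"
      using Suc t by simp
    from tp_upto_add_previous_row[OF this c[OF t(3)], of t]
    have "tp_upto N (\<lambda>i j. if i = Suc t then A (Suc t) j + c t * A t j
        else if i < Suc (Suc t) then A i j else B i j)"
      by (simp cong: if_cong)
    also have "?this \<longleftrightarrow> ?case"
      unfolding t by (rule tp_upto_cong) (auto simp: B less_Suc_eq)
    finally show ?case .
  qed
  show ?thesis
  proof (cases N)
    case 0
    then show ?thesis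
      using assms(1) tp_upto_cong[of N A B] by simp
  next
    case (Suc M)
    have "tp_upto N (\<lambda>i j. if i < N - M then A i j else B i j) \<longleftrightarrow> tp_upto N B"
      by (rule tp_upto_cong) (auto simp: B Suc)
    with rows[of M] show ?thesis
      by (simp add: Suc)
  qed
qed

text \<open>The recurrence refers to the new row \<open>B i\<close>, so \<open>A = L B\<close> with
  \<open>L\<close> unit lower bidiagonal with subdiagonal \<open>- c\<close>. Updating from the top
  down makes the previous row the new one at each step.\<close>

lemma tp_upto_lower_bidiagonal_inverse:
  assumes "tp_upto N A" and c: "\<And>i. Suc i < N \<Longrightarrow> 0 \<le> c i"
    and B: "\<And>j. B 0 j = A 0 j" "\<And>i j. B (Suc i) j = A (Suc i) j + c i * B i j"
  shows "tp_upto N B"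
proof -
  have rows: "tp_upto N (\<lambda>i j. if i \<le> s then B i j else A i j)" if "s < N" for s
    using that
  proof (induction s)
    case 0
    have "tp_upto N (\<lambda>i j. if i \<le> 0 then B i j else A i j) = tp_upto N A"
      by (rule tp_upto_cong) (auto simp: B)
    then show ?case
      using assms(1) by blast
  next
    case (Suc s)
    then have "tp_upto N (\<lambda>i j. if i \<le> s then B i j else A i j)"
      by simp
    from tp_upto_add_previous_row[OF this c[OF Suc.prems], of s]
    have "tp_upto N (\<lambda>i j. if i = Suc s then A (Suc s) j + c s * B s j
        else if i \<le> s then B i j else A i j)"
      by (simp cong: if_cong)
    also have "?this \<longleftrightarrow> ?case"
      by (rule tp_upto_cong) (auto simp: B le_Suc_eq)
    finally show ?case .
  qed
  have "tp_upto N (\<lambda>i j. if i \<le> N - 1 then B i j else A i j) \<longleftrightarrow> tp_upto N B"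
    by (rule tp_upto_cong) auto
  then show ?thesis
    using rows[of "N - 1"] assms(1) tp_upto_cong[of N A B] by (cases N) auto
qed

section \<open>Bordering a matrix by a leading 1\<close>

lemma strict_mono_on_pos:
  assumes "strict_mono_on {..<r} (f :: nat \<Rightarrow> nat)" "0 < a" "a < r"
  shows "0 < f a"
  using assms by (metis bot_nat_0.not_eq_extremum lessThan_iff less_trans not_less0 strict_mono_onD)

lemma strict_mono_on_pred:
  assumes "strict_mono_on {..<r} (f :: nat \<Rightarrow> nat)" "\<And>a. a < r \<Longrightarrow> 0 < f a"
  shows "strict_mono_on {..<r} (\<lambda>a. f a - 1)"
  using assms by (force simp: strict_mono_on_def Suc_le_eq intro!: diff_less_mono)

lemma tp_upto_bordered:
  assumes A: "tp_upto N A"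
    and B: "B 0 0 = 1" "\<And>j. B 0 (Suc j) = 0" "\<And>i. B (Suc i) 0 = 0"
      "\<And>i j. B (Suc i) (Suc j) = A i j"
  shows "tp_upto (Suc N) B"
  unfolding tp_upto_def
proof (intro allI impI)
  fix r :: nat and f g
  assume f: "strict_mono_on {..<r} f" "f ` {..<r} \<subseteq> {..<Suc N}"
    and g: "strict_mono_on {..<r} g" "g ` {..<r} \<subseteq> {..<Suc N}"
  have shifted: "0 \<le> minor B k f' g'"
    if "strict_mono_on {..<k} f'" "strict_mono_on {..<k} g'"
      "\<And>a. a < k \<Longrightarrow> 0 < f' a \<and> f' a < Suc N" "\<And>a. a < k \<Longrightarrow> 0 < g' a \<and> g' a < Suc N"
    for k f' g'
  proof -
    have "minor B k f' g' = minor A k (\<lambda>a. f' a - 1) (\<lambda>a. g' a - 1)"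
      using that(3,4) by (intro minor_cong) (metis B(4) Suc_diff_1)
    moreover have "strict_mono_on {..<k} (\<lambda>a. f' a - 1)" "strict_mono_on {..<k} (\<lambda>a. g' a - 1)"
      using that by (blast intro: strict_mono_on_pred)+
    moreover have "(\<lambda>a. f' a - 1) ` {..<k} \<subseteq> {..<N}" "(\<lambda>a. g' a - 1) ` {..<k} \<subseteq> {..<N}"
      using that(3,4) by fastforce+
    ultimately show ?thesis
      using A by (auto simp: tp_upto_def)
  qed
  have row0: "B 0 j = of_bool (j = 0)" and col0: "B i 0 = of_bool (i = 0)" for i j
    using B by (cases j; simp)(cases i; simp add: B)
  let ?M = "mat r r (\<lambda>(a, b). B (f a) (g b))"
  show "0 \<le> minor B r f g"
  proof (cases r)
    case 0
    then show ?thesis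
      by (simp add: minor_def)
  next
    case (Suc k)
    have fpos: "0 < f a" and gpos: "0 < g a" if "0 < a" "a < r" for a
      using strict_mono_on_pos f(1) g(1) that by auto
    have bound: "f a < Suc N" "g a < Suc N" if "a < r" for a
      using f(2) g(2) that by auto
    have exp: "det ?M = (\<Sum>j<r. B (f 0) (g j) * cofactor ?M 0 j)"
      using laplace_expansion_row[of ?M r 0] Suc by simp
    have exp': "det ?M = (\<Sum>i<r. B (f i) (g 0) * cofactor ?M i 0)"
      using laplace_expansion_column[of ?M r 0] Suc by simp
    \<comment> \<open>By strict monotonicity only \<open>f 0\<close> and \<open>g 0\<close> can be
      0. If neither is, this is a minor of \<open>A\<close>; if exactly one is, there is a zero row
      or column; if both are, expansion along the first row leaves a minor of
      \<open>A\<close>.\<close>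
    consider "f 0 > 0" "g 0 > 0" | "f 0 = 0" "g 0 > 0" | "f 0 > 0" "g 0 = 0" | "f 0 = 0" "g 0 = 0"
      by blast
    then show ?thesis
    proof cases
      case 1
      then have "0 < f a \<and> 0 < g a" if "a < r" for a
        using fpos gpos that by (cases "a = 0") auto
      then show ?thesis
        using f(1) g(1) bound by (intro shifted) auto
    next
      case 2
      then have "g a \<noteq> 0" if "a < r" for a
        using gpos[of a] that by (cases "a = 0") auto
      then have "det ?M = 0"
        unfolding exp using 2 by (intro sum.neutral) (auto simp: row0)
      then show ?thesis
        by (simp add: minor_def)
    next
      case 3
      then have "f a \<noteq> 0" if "a < r" for a
        using fpos[of a] that by (cases "a = 0") auto
      then have "det ?M = 0"
        unfolding exp' using 3 by (intro sum.neutral) (auto simp: col0)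
      then show ?thesis
        by (simp add: minor_def)
    next
      case 4
      have "g a \<noteq> 0" if "0 < a" "a < r" for a
        using gpos[of a] that by auto
      then have "det ?M = (\<Sum>j<r. if j = 0 then cofactor ?M 0 0 else 0)"
        unfolding exp using 4 by (intro sum.cong) (auto simp: row0)
      also have "\<dots> = cofactor ?M 0 0"
        using Suc by simp
      also have "\<dots> = minor B k (\<lambda>a. f (Suc a)) (\<lambda>a. g (Suc a))"
        unfolding cofactor_def minor_def mat_delete_def
        using Suc by (auto intro!: arg_cong[where f = det] eq_matI)
      also have "0 \<le> \<dots>"
        using f(1) g(1) fpos gpos bound Suc by (intro shifted) (auto simp: strict_mono_on_def)
      finally show ?thesis
        by (simp add: minor_def)
    qed
  qed
qed

section \<open>Recurrences for the generalized Pascal matrix\<close>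

definition pascal_entry :: "real \<Rightarrow> real \<Rightarrow> nat \<Rightarrow> nat \<Rightarrow> real" where
  "pascal_entry l x i j = (if j \<le> i then rising_power x l (i - j) * real (i choose j) else 0)"

lemma rising_power_0 [simp]: "rising_power x l 0 = 1"
  by (simp add: rising_power_def)

lemma rising_power_Suc: "rising_power x l (Suc m) = (x + real m * l) * rising_power x l m"
  by (simp add: rising_power_def)

lemma rising_power_Suc_left: "rising_power x l (Suc m) = x * rising_power (x + l) l m"
  unfolding rising_power_def by (subst prod.lessThan_Suc_shift) (simp add: algebra_simps)

text \<open>One step of Neville elimination, outside the first column. Below the diagonal, with
  \<open>m = i - j - 1\<close>, the factor \<open>rising_power x l m\<close> is common to all terms,
  and what remains is linear in \<open>x\<close>.\<close>

lemma pascal_entry_neville: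
  "pascal_entry l x (Suc i) (Suc j) =
    pascal_entry l (x - l) i j + (x + real i * l) * pascal_entry l x i (Suc j)"
proof -
  consider "j < i" | "j = i" | "j > i" by linarith
  then show ?thesis
  proof cases
    case 1
    then obtain m where i: "i = Suc (j + m)"
      using less_iff_Suc_add by auto
    let ?u = "real (i choose j)" and ?v = "real (i choose Suc j)"
    have "Suc j * (i choose Suc j) = (i - j) * (i choose j)"
      by (simp only: binomial_absorption binomial_absorb_comp)
    then have "real (Suc j) * ?v = real (Suc m) * ?u"
      using i by (metis add_Suc_right add_diff_cancel_left' of_nat_mult)
    then have "(real j + 1) * ?v = (real m + 1) * ?u" "real i = real j + real m + 1"
      using i by (simp_all add: algebra_simps)
    \<comment> \<open>The difference of the two sides is \<open>l\<close> times the absorption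
      identity just obtained, hence 0.\<close>
    moreover from this(2) have "(x + real m * l) * (?u + ?v) - ((x - l) * ?u + (x + real i * l) * ?v) =
        l * ((real m + 1) * ?u - (real j + 1) * ?v)"
      by (simp add: algebra_simps)
    ultimately have *: "(x + real m * l) * (?u + ?v) = (x - l) * ?u + (x + real i * l) * ?v"
      by simp
    have "(x + real m * l) * rising_power x l m * (?u + ?v) =
        rising_power x l m * ((x + real m * l) * (?u + ?v))"
      by (simp only: mult_ac)
    also have "\<dots> = (x - l) * rising_power x l m * ?u + (x + real i * l) * (rising_power x l m * ?v)"
      unfolding * by (simp only: distrib_left mult_ac)
    finally have "(x + real m * l) * rising_power x l m * (?u + ?v) = \<dots>" .
    moreover have "rising_power (x - l) l (Suc m) = (x - l) * rising_power x l m"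
      by (simp add: rising_power_Suc_left)
    moreover have "i - j = Suc m" "i - Suc j = m" "Suc i - Suc j = Suc m"
      using i by auto
    ultimately show ?thesis
      using 1 by (simp add: pascal_entry_def rising_power_Suc)
  qed (auto simp: pascal_entry_def)
qed

text \<open>This is P[x - l] = P[-l] P[x]. The matrix P[-l] is bidiagonal because
  \<open>rising_power (- l) l m\<close> contains the factor 0 for m \<ge> 2.\<close>

lemma pascal_entry_shift:
  "pascal_entry l (x - l) (Suc i) j =
    pascal_entry l x (Suc i) j + (- l * real (Suc i)) * pascal_entry l x i j"
proof -
  consider "j \<le> i" | "j = Suc i" | "j > Suc i" by linarith
  then show ?thesis
  proof cases
    case 1
    then obtain m where i: "i = j + m"
      using le_Suc_ex by blast
    let ?u = "real (i choose j)" and ?v = "real (Suc i choose j)"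
    have "(Suc i - j) * (Suc i choose j) = Suc i * (i choose j)"
      using binomial_absorb_comp[of "Suc i" j] by simp
    then have *: "real (Suc m) * ?v = real (Suc i) * ?u"
      using i by (metis add_Suc_right add_diff_cancel_left' of_nat_mult)
    have "(x - l) * rising_power x l m * ?v =
        (x + real m * l) * rising_power x l m * ?v - l * rising_power x l m * (real (Suc m) * ?v)"
      by (simp add: algebra_simps del: binomial_Suc_Suc)
    also have "\<dots> = (x + real m * l) * rising_power x l m * ?v
        + (- l * real (Suc i)) * (rising_power x l m * ?u)"
      unfolding * by (simp add: algebra_simps del: of_nat_Suc binomial_Suc_Suc)
    finally have "(x - l) * rising_power x l m * ?v = \<dots>" .
    moreover have "rising_power (x - l) l (Suc m) = (x - l) * rising_power x l m"
      by (simp add: rising_power_Suc_left)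
    moreover have "i - j = m" "Suc i - j = Suc m"
      using i by auto
    ultimately show ?thesis
      using 1 by (simp add: pascal_entry_def rising_power_Suc del: of_nat_Suc binomial_Suc_Suc)
  qed (auto simp: pascal_entry_def)
qed

section \<open>Sufficiency of the two conditions\<close>

lemma tp_upto_pascal_entry_Suc:
  assumes "tp_upto N (pascal_entry l (x - l))" "\<And>i. i < N \<Longrightarrow> 0 \<le> x + real i * l"
  shows "tp_upto (Suc N) (pascal_entry l x)"
proof -
  \<comment> \<open>\<open>A\<close> is the result of eliminating the first column of P[x]; undoing
    the elimination recovers P[x].\<close>
  define A where "A i j = (case (i, j) of (0, 0) \<Rightarrow> 1 | (0, Suc _) \<Rightarrow> 0 | (Suc _, 0) \<Rightarrow> 0
    | (Suc i, Suc j) \<Rightarrow> pascal_entry l (x - l) i j)" for i j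
  have "tp_upto (Suc N) A"
    by (rule tp_upto_bordered[OF assms(1)]) (auto simp: A_def)
  then show ?thesis
  proof (rule tp_upto_lower_bidiagonal_inverse[where c = "\<lambda>i. x + real i * l"])
    show "0 \<le> x + real i * l" if "Suc i < Suc N" for i
      using assms(2) that by simp
    show "pascal_entry l x 0 j = A 0 j" for j
      by (cases j) (auto simp: A_def pascal_entry_def)
    show "pascal_entry l x (Suc i) j = A (Suc i) j + (x + real i * l) * pascal_entry l x i j" for i j
      \<comment> \<open>Column 0 is separate: there the recurrence is that of the rising power
        itself.\<close>
      by (cases j) (simp_all add: A_def pascal_entry_neville, simp add: pascal_entry_def rising_power_Suc)
  qed
qed

lemma pascal_entry_0: "pascal_entry l 0 i j = of_bool (i = j)"
proof -
  have "rising_power 0 l m = of_bool (m = 0)" for m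
    by (cases m) (simp_all add: rising_power_Suc_left)
  then show ?thesis
    by (auto simp: pascal_entry_def)
qed

lemma tp_upto_0: "tp_upto 0 A"
  by (auto simp: tp_upto_def minor_def lessThan_empty_iff)

text \<open>The bound is (n - 1) \<bar>l\<bar> for size \<open>N = n + 1\<close>, with real
  subtraction. Passing to \<open>x - l\<close> costs at most one \<bar>l\<bar>, just as the bound
  drops with the size, and it keeps all multipliers nonnegative.\<close>

lemma tp_upto_pascal_entry_ge:
  assumes "(real N - 2) * \<bar>l\<bar> \<le> x"
  shows "tp_upto N (pascal_entry l x)"
  using assms
proof (induction N arbitrary: x)
  case 0
  then show ?case
    by (simp add: tp_upto_0)
next
  case (Suc N)
  show ?case
  proof (rule tp_upto_pascal_entry_Suc)
    have "(real N - 2) * \<bar>l\<bar> \<le> x - l"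
      using Suc.prems by (simp add: algebra_simps)
    then show "tp_upto N (pascal_entry l (x - l))"
      by (rule Suc.IH)
    show "0 \<le> x + real i * l" if "i < N" for i
    proof -
      have "real i * (- l) \<le> real i * \<bar>l\<bar>"
        by (intro mult_left_mono) auto
      also have "\<dots> \<le> (real (Suc N) - 2) * \<bar>l\<bar>"
        using that by (intro mult_right_mono) auto
      finally show ?thesis
        using Suc.prems by simp
    qed
  qed
qed

lemma tp_upto_identity: "tp_upto N (\<lambda>i j. of_bool (i = j))"
  by (induction N) (auto intro: tp_upto_0 tp_upto_bordered)

text \<open>For l \<ge> 0 elimination lowers \<open>k\<close> and \<open>N\<close> together until
  the identity or the empty matrix is reached. For l < 0 the multiplier \<open>x + i l\<close> is
  negative once i > k, so induction on \<open>k\<close> with bidiagonal factors is used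
  instead.\<close>

lemma tp_upto_pascal_entry_multiple:
  "tp_upto N (pascal_entry l (real k * \<bar>l\<bar>))"
proof (cases "l \<ge> 0")
  case True
  show ?thesis
  proof (induction N arbitrary: k)
    case 0
    then show ?case
      by (simp add: tp_upto_0)
  next
    case (Suc N)
    show ?case
    proof (cases k)
      case 0
      then show ?thesis
        using tp_upto_identity by (simp add: pascal_entry_0[abs_def])
    next
      case (Suc m)
      have "real k * \<bar>l\<bar> - l = real m * \<bar>l\<bar>"
        using True by (simp add: Suc algebra_simps)
      then show ?thesis
        using Suc.IH[of m] True by (intro tp_upto_pascal_entry_Suc) auto
    qed
  qed
next
  case False
  show ?thesis
  proof (induction k)
    case 0
    then show ?case
      using tp_upto_identity by (simp add: pascal_entry_0[abs_def])
  next
    case (Suc k)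
    have x: "real (Suc k) * \<bar>l\<bar> = real k * \<bar>l\<bar> - l"
      using False by (simp add: algebra_simps)
    show ?case
      unfolding x using Suc
    proof (rule tp_upto_lower_bidiagonal[where c = "\<lambda>i. - l * real (Suc i)"])
      show "pascal_entry l (real k * \<bar>l\<bar> - l) 0 j = pascal_entry l (real k * \<bar>l\<bar>) 0 j" for j
        by (simp add: pascal_entry_def)
      show "0 \<le> - l * real (Suc i)" for i
        using False by (intro mult_nonneg_nonneg) auto
    qed (rule pascal_entry_shift)
  qed
qed

section \<open>Index sets versus increasing maps\<close>

lemma strict_mono_on_pick: "strict_mono_on {..<card I} (pick I)"
  by (auto intro!: strict_mono_onI pick_mono_le)

lemma totally_positive_iff_tp_upto:
  "totally_positive (mat N N (\<lambda>(i, j). A i j)) \<longleftrightarrow> tp_upto N A"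
proof
  assume tp: "tp_upto N A"
  show "totally_positive (mat N N (\<lambda>(i, j). A i j))"
    unfolding totally_positive_def
  proof (intro allI impI)
    fix I J
    assume *: "I \<subseteq> {0..<dim_row (mat N N (\<lambda>(i, j). A i j))}"
      "J \<subseteq> {0..<dim_col (mat N N (\<lambda>(i, j). A i j))}" "card I = card J"
    then have IJ: "I \<subseteq> {..<N}" "J \<subseteq> {..<N}"
      by auto
    then have fin: "finite I" "finite J"
      using finite_subset by blast+
    have sets: "{i. i < N \<and> i \<in> I} = I" "{i. i < N \<and> i \<in> J} = J"
      using IJ by auto
    have pick: "pick I a \<in> I" "pick J a \<in> J" if "a < card J" for a
      using that * fin by (auto intro: pick_in_set_le)
    then have lt: "pick I a < N" "pick J a < N" if "a < card J" for a
      using IJ that by blast+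
    have "submatrix (mat N N (\<lambda>(i, j). A i j)) I J =
        mat (card J) (card J) (\<lambda>(a, b). A (pick I a) (pick J b))"
      unfolding submatrix_def using lt * by (intro eq_matI) (auto simp: sets)
    then have "det (submatrix (mat N N (\<lambda>(i, j). A i j)) I J) =
        minor A (card J) (pick I) (pick J)"
      by (simp add: minor_def)
    also have "0 \<le> \<dots>"
      using lt strict_mono_on_pick[of I] strict_mono_on_pick[of J] *(3)
      by (intro tp_uptoD[OF tp]) auto
    finally show "0 \<le> det (submatrix (mat N N (\<lambda>(i, j). A i j)) I J)" .
  qed
next
  assume tp: "totally_positive (mat N N (\<lambda>(i, j). A i j))"
  show "tp_upto N A"
    unfolding tp_upto_def
  proof (intro allI impI)
    fix r :: nat and f g
    assume f: "strict_mono_on {..<r} f" "f ` {..<r} \<subseteq> {..<N}"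
      and g: "strict_mono_on {..<r} g" "g ` {..<r} \<subseteq> {..<N}"
    have card: "card (h ` {..<r}) = r" if "strict_mono_on {..<r} h" for h :: "nat \<Rightarrow> nat"
      using that by (simp add: card_image strict_mono_on_imp_inj_on)
    \<comment> \<open>Exactly \<open>a\<close> elements of the image lie below \<open>h a\<close>,
      so enumerating the image gives back \<open>h\<close>.\<close>
    have pick: "pick (h ` {..<r}) a = h a" if h: "strict_mono_on {..<r} h" and "a < r" for h a
    proof -
      have "{x \<in> h ` {..<r}. x < h a} = h ` {..<a}"
        using \<open>a < r\<close> by (auto simp: strict_mono_on_less[OF h])
      moreover have "card (h ` {..<a}) = a"
        using \<open>a < r\<close> by (subst card_image)
          (auto intro: inj_on_subset[OF strict_mono_on_imp_inj_on[OF h]])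
      ultimately show ?thesis
        using pick_card_in_set[of "h a" "h ` {..<r}"] \<open>a < r\<close> by simp
    qed
    have sets: "{i. i < N \<and> i \<in> f ` {..<r}} = f ` {..<r}"
      "{i. i < N \<and> i \<in> g ` {..<r}} = g ` {..<r}"
      using f(2) g(2) by auto
    have "submatrix (mat N N (\<lambda>(i, j). A i j)) (f ` {..<r}) (g ` {..<r}) =
        mat r r (\<lambda>(a, b). A (f a) (g b))"
      unfolding submatrix_def using f g
      by (intro eq_matI) (auto simp: sets card pick image_subset_iff)
    moreover have "0 \<le> det (submatrix (mat N N (\<lambda>(i, j). A i j)) (f ` {..<r}) (g ` {..<r}))"
    proof (rule tp[unfolded totally_positive_def, rule_format])
      show "f ` {..<r} \<subseteq> {0..<dim_row (mat N N (\<lambda>(i, j). A i j))}"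
        "g ` {..<r} \<subseteq> {0..<dim_col (mat N N (\<lambda>(i, j). A i j))}"
        using f(2) g(2) by auto
      show "card (f ` {..<r}) = card (g ` {..<r})"
        using f(1) g(1) by (simp add: card)
    qed
    ultimately show "0 \<le> minor A r f g"
      by (simp add: minor_def)
  qed
qed

section \<open>Necessity: the inverse matrix and sign analysis\<close>

text \<open>Rescaling by \<open>l\<close> makes the Vandermonde identity for
  \<open>pochhammer\<close> available.\<close>

lemma rising_power_eq_pochhammer:
  assumes "l \<noteq> 0"
  shows "rising_power x l m = l ^ m * pochhammer (x / l) m"
  using assms
  by (induction m) (simp_all add: rising_power_Suc pochhammer_Suc field_simps)

lemma rising_power_uminus: "rising_power (- x) l m = (- 1) ^ m * rising_power x (- l) m"
  by (induction m) (simp_all add: rising_power_Suc algebra_simps)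

text \<open>The sum is entry (i, 0) of P[x] P[-x]. The Vandermonde identity collapses it to a
  Pochhammer symbol at \<open>- x / l + x / l = 0\<close>.\<close>

lemma sum_pascal_entry_rising_power:
  assumes "l \<noteq> 0" "i \<le> m"
  shows "(\<Sum>k\<le>m. pascal_entry l x i k * rising_power (- x) l k) = of_bool (i = 0)"
proof -
  have "(\<Sum>k\<le>m. pascal_entry l x i k * rising_power (- x) l k) =
      (\<Sum>k\<le>i. pascal_entry l x i k * rising_power (- x) l k)"
    using assms(2) by (intro sum.mono_neutral_right) (auto simp: pascal_entry_def)
  also have "\<dots> = (\<Sum>k\<le>i. l ^ i * (of_nat (i choose k) *
      pochhammer (- x / l) k * pochhammer (x / l) (i - k)))"
  proof (intro sum.cong refl)
    fix k assume "k \<in> {..i}"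
    then have "l ^ i = l ^ k * l ^ (i - k)"
      by (simp add: power_add[symmetric])
    with \<open>k \<in> {..i}\<close> show "pascal_entry l x i k * rising_power (- x) l k = l ^ i *
        (of_nat (i choose k) * pochhammer (- x / l) k * pochhammer (x / l) (i - k))"
      by (simp add: pascal_entry_def rising_power_eq_pochhammer[OF assms(1)])
  qed
  also have "\<dots> = l ^ i * pochhammer (- x / l + x / l) i"
    unfolding pochhammer_binomial_sum by (simp add: sum_distrib_left)
  also have "\<dots> = of_bool (i = 0)"
    by (cases i) (simp_all add: pochhammer_rec)
  finally show ?thesis .
qed

text \<open>This minor is, up to sign, the entry \<open>(m, 0)\<close> of the inverse matrix \<open>P[-x]\<close>.\<close>

lemma minor_pascal_entry_subdiagonal:
  assumes "l \<noteq> 0"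
  shows "minor (pascal_entry l x) m Suc id = rising_power x (- l) m"
proof -
  define M where "M = mat (Suc m) (Suc m) (\<lambda>(i, j). pascal_entry l x i j)"
  \<comment> \<open>The first column of P[-x].\<close>
  define q where "q = vec (Suc m) (rising_power (- x) l)"
  have M: "M \<in> carrier_mat (Suc m) (Suc m)" and q: "q \<in> carrier_vec (Suc m)"
    by (auto simp: M_def q_def)
  have "det M = prod_list (diag_mat M)"
    by (rule det_lower_triangular[OF _ M]) (simp add: M_def pascal_entry_def)
  also have "diag_mat M = map (\<lambda>_. 1) [0..<Suc m]"
    unfolding diag_mat_def M_def by (auto simp: pascal_entry_def)
  finally have det: "det M = 1"
    by (simp add: prod_list_replicate map_replicate_const del: upt_Suc)
  have Mq: "M *\<^sub>v q = unit_vec (Suc m) 0"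
    using sum_pascal_entry_rising_power[OF assms, of _ m x]
    by (intro eq_vecI)
      (auto simp: M_def q_def scalar_prod_def atLeast0LessThan lessThan_Suc_atMost unit_vec_def)
  have "adj_mat M * M = 1\<^sub>m (Suc m)"
    using adj_mat(3)[OF M] by (auto simp: det intro!: eq_matI)
  then have "q = (adj_mat M * M) *\<^sub>v q"
    using q by simp
  also have "\<dots> = adj_mat M *\<^sub>v unit_vec (Suc m) 0"
    using adj_mat(1)[OF M] M q by (simp add: assoc_mult_mat_vec Mq)
  finally have "q $ m = (adj_mat M *\<^sub>v unit_vec (Suc m) 0) $ m"
    by simp
  \<comment> \<open>The adjugate is the inverse since \<open>det M = 1\<close>, and it transposes
    indices. Deleting row 0 and column \<open>m\<close> leaves the rows \<open>Suc a\<close> and the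
    columns \<open>b\<close> with a, b < m.\<close>
  also have "\<dots> = cofactor M 0 m"
    using adj_mat(1)[OF M] M by (simp add: adj_mat_def)
  also have "\<dots> = (- 1) ^ m * minor (pascal_entry l x) m Suc id"
    unfolding cofactor_def minor_def mat_delete_def
    by (auto simp: M_def intro!: arg_cong[where f = det] eq_matI)
  finally have "(- 1) ^ m * rising_power x (- l) m = (- 1) ^ m * minor (pascal_entry l x) m Suc id"
    by (simp add: q_def rising_power_uminus)
  then show ?thesis
    by simp
qed

lemma rising_power_nonneg_cases:
  assumes "d > 0" and nonneg: "\<And>m. 1 \<le> m \<Longrightarrow> m \<le> n \<Longrightarrow> 0 \<le> rising_power x (- d) m" and "n \<ge> 1"
  shows "(real n - 1) * d \<le> x \<or> (\<exists>k\<in>{0..n - 1}. x = real k * d)"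
proof (rule ccontr)
  assume neg: "\<not> ?thesis"
  have "0 \<le> x"
    using nonneg[of 1] \<open>n \<ge> 1\<close> by (simp add: rising_power_def)
  define k where "k = nat \<lfloor>x / d\<rfloor>"
  have k: "real k * d \<le> x" "x < (real k + 1) * d"
  proof -
    have "real k = of_int \<lfloor>x / d\<rfloor>"
      using \<open>0 \<le> x\<close> \<open>d > 0\<close> by (simp add: k_def)
    then have "real k \<le> x / d" "x / d < real k + 1"
      by linarith+
    then show "real k * d \<le> x" "x < (real k + 1) * d"
      using \<open>d > 0\<close> by (simp_all add: field_simps)
  qed
  have "real k * d < (real n - 1) * d"
    using k(1) neg by linarith
  then have "real k < real n - 1"
    using \<open>d > 0\<close> by simp
  then have kn: "k + 2 \<le> n"
    by linarith
  \<comment> \<open>Equality would be one of the excluded multiples, as k \<le> n - 1.\<close>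
  then have "real k * d < x"
    using k(1) neg by force
  \<comment> \<open>The factors \<open>x - i d\<close> with i \<le> k are positive; the next one,
    \<open>x - (k + 1) d\<close>, is negative and flips the sign.\<close>
  have "0 < rising_power x (- d) (Suc k)"
    unfolding rising_power_def
  proof (rule prod_pos)
    fix i assume "i \<in> {..<Suc k}"
    then have "real i * d \<le> real k * d"
      using \<open>d > 0\<close> by simp
    then show "0 < x + real i * - d"
      using \<open>real k * d < x\<close> by simp
  qed
  then have "rising_power x (- d) (Suc (Suc k)) < 0"
    unfolding rising_power_Suc[of _ _ "Suc k"] using k(2)
    by (intro mult_neg_pos) (simp_all add: algebra_simps)
  then show False
    using nonneg[of "Suc (Suc k)"] kn by simp
qed

theorem corollary7:
  fixes x l :: real and n :: nat
  assumes "n \<ge> 1"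
  shows "totally_positive (pascal_mat n l x) \<longleftrightarrow>
    x \<ge> (real n - 1) * \<bar>l\<bar> \<or> (\<exists>k\<in>{0..n - 1}. x = real k * \<bar>l\<bar>)"
proof -
  have iff: "totally_positive (pascal_mat n l x) \<longleftrightarrow> tp_upto (n + 1) (pascal_entry l x)"
    unfolding pascal_mat_def totally_positive_iff_tp_upto[symmetric] pascal_entry_def ..
  show ?thesis
    unfolding iff
  proof
    assume "x \<ge> (real n - 1) * \<bar>l\<bar> \<or> (\<exists>k\<in>{0..n - 1}. x = real k * \<bar>l\<bar>)"
    then show "tp_upto (n + 1) (pascal_entry l x)"
      using tp_upto_pascal_entry_ge[of "n + 1" l x] tp_upto_pascal_entry_multiple by auto
  next
    assume tp: "tp_upto (n + 1) (pascal_entry l x)"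
    have entry: "0 \<le> rising_power x l m" if "m \<le> n" for m
    proof -
      have "0 \<le> minor (pascal_entry l x) 1 (\<lambda>_. m) (\<lambda>_. 0)"
        using that by (intro tp_uptoD[OF tp]) (auto simp: strict_mono_on_def)
      then show ?thesis
        by (simp add: minor_def det_single pascal_entry_def)
    qed
    show "x \<ge> (real n - 1) * \<bar>l\<bar> \<or> (\<exists>k\<in>{0..n - 1}. x = real k * \<bar>l\<bar>)"
    \<comment> \<open>For zero step the claim is just x \<ge> 0, which is the entry with m =
      1.\<close>
    proof (cases "l = 0")
      case True
      then show ?thesis
        using entry[of 1] assms by (simp add: rising_power_def)
    next
      case False
      have "0 \<le> rising_power x (- l) m" if "m \<le> n" for m
        unfolding minor_pascal_entry_subdiagonal[OF False, symmetric]
        using that by (intro tp_uptoD[OF tp]) (auto simp: strict_mono_on_def)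
      \<comment> \<open>The step \<open>- \<bar>l\<bar>\<close> is \<open>- l\<close> for l \<ge> 0,
        covered by the subdiagonal minors, and \<open>l\<close> otherwise, covered by the first
        column.\<close>
      with entry have "0 \<le> rising_power x (- \<bar>l\<bar>) m" if "m \<le> n" for m
        using that by (cases "l \<ge> 0") auto
      then show ?thesis
        using rising_power_nonneg_cases[of "\<bar>l\<bar>" n x] False assms by auto
    qed
  qed
qed

end
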